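(* Let $A \in \mathbb{R}^{2n \times 2n}$ be a symmetric positive definite symplectic matrix, partitioned into $n \times n$ blocks as $$A=\begin{pmatrix} A_{11} & A_{12} \\ A_{12}^T & A_{22}\end{pmatrix}.$$ Let $A_{11}=L_{11}L_{11}^T$ be the Cholesky decomposition of $A_{11}$. Then $A=LL^T$, where $$L=\begin{pmatrix} L_{11} & 0 \\ L_{21} & L_{22}\end{pmatrix}=\begin{pmatrix} L_{11} & 0 \\ (L_{11}^{-1}A_{12})^T & L_{11}^{-T}\end{pmatrix},$$ and $L$ is symplectic. Moreover, if $S=A_{22}-A_{12}^TA_{11}^{-1}A_{12}$ is the Schur complement of $A_{11}$ in $A$ and $S=UU^T$ is the Reverse Cholesky decomposition of $S$, then $L_{22}=L_{11}^{-T}=U$.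
   Context: Let $J=\begin{pmatrix} 0 & I_n \\ -I_n & 0\end{pmatrix}\in\mathbb{R}^{2n\times 2n}$, where $I_n$ is the $n\times n$ identity matrix. A matrix $A\in\mathbb{R}^{2n\times 2n}$ is symplectic if $A^TJA=J$. For a symmetric positive definite matrix $M\in\mathbb{R}^{m\times m}$: the Cholesky decomposition is the unique factorization $M=LL^T$ with $L$ lower triangular with positive diagonal entries; the Reverse Cholesky decomposition is the unique factorization $M=UU^T$ with $U$ upper triangular with positive diagonal entries. The notation $X^{-T}$ means $(X^{-1})^T$. *)

theory Defs
  imports Complex_Main "Jordan_Normal_Form.Gauss_Jordan_Elimination"
begin

definition symp_J :: "nat \<Rightarrow> real mat" where
  "symp_J n = four_block_mat (0\<^sub>m n n) (1\<^sub>m n) (- 1\<^sub>m n) (0\<^sub>m n n)"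

definition symplectic :: "nat \<Rightarrow> real mat \<Rightarrow> bool" where
  "symplectic n A \<longleftrightarrow>
     A \<in> carrier_mat (2 * n) (2 * n) \<and> transpose_mat A * symp_J n * A = symp_J n"

definition sym_pos_def :: "nat \<Rightarrow> real mat \<Rightarrow> bool" where
  "sym_pos_def m M \<longleftrightarrow>
     M \<in> carrier_mat m m \<and> transpose_mat M = M \<and>
     (\<forall>x \<in> carrier_vec m. x \<noteq> 0\<^sub>v m \<longrightarrow> x \<bullet> (M *\<^sub>v x) > 0)"

definition lower_triangular :: "real mat \<Rightarrow> bool" where
  "lower_triangular M \<longleftrightarrow> (\<forall>j < dim_col M. \<forall>i < j. M $$ (i, j) = 0)"

definition pos_diag :: "real mat \<Rightarrow> bool" where
  "pos_diag M \<longleftrightarrow> (\<forall>i < dim_row M. M $$ (i, i) > 0)"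

text \<open>The two factorizations are rendered as relations between a matrix and its factor; only a
  symmetric positive definite matrix has such factors, and it has exactly one of each kind.\<close>

definition is_cholesky :: "nat \<Rightarrow> real mat \<Rightarrow> real mat \<Rightarrow> bool" where
  "is_cholesky m M L \<longleftrightarrow>
     L \<in> carrier_mat m m \<and> lower_triangular L \<and> pos_diag L \<and> M = L * transpose_mat L"

definition is_reverse_cholesky :: "nat \<Rightarrow> real mat \<Rightarrow> real mat \<Rightarrow> bool" where
  "is_reverse_cholesky m M U \<longleftrightarrow>
     U \<in> carrier_mat m m \<and> upper_triangular U \<and> pos_diag U \<and> M = U * transpose_mat U"

text \<open>The library's \<open>mat_inverse\<close> is \<open>None\<close> exactly on the matrices that have no inverse, so
  \<open>inv_mat\<close> is meaningful only under \<open>invertible_mat\<close>.\<close>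

definition inv_mat :: "real mat \<Rightarrow> real mat" where
  "inv_mat M = the (mat_inverse M)"

definition schur_complement :: "real mat \<Rightarrow> real mat \<Rightarrow> real mat \<Rightarrow> real mat" where
  "schur_complement A11 A12 A22 = A22 - transpose_mat A12 * inv_mat A11 * A12"

end

theory Submission
  imports Defs "Jordan_Normal_Form.Determinant"
begin

text \<open>Comparing blocks in \<open>A\<^sup>T J A = J\<close> gives \<open>A\<^sub>1\<^sub>1 A\<^sub>1\<^sub>2\<^sup>T = A\<^sub>1\<^sub>2 A\<^sub>1\<^sub>1\<close> and
  \<open>A\<^sub>1\<^sub>1 A\<^sub>2\<^sub>2 - A\<^sub>1\<^sub>2\<^sup>2 = I\<close>. Hence \<open>S = A\<^sub>2\<^sub>2 - A\<^sub>1\<^sub>1\<^sup>-\<^sup>1 A\<^sub>1\<^sub>2\<^sup>2 = A\<^sub>1\<^sub>1\<^sup>-\<^sup>1 = K\<^sup>T K\<close> with \<open>K = L\<^sub>1\<^sub>1\<^sup>-\<^sup>1\<close>, which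
  yields the factorization of \<open>A\<close>; the first relation makes \<open>K A\<^sub>1\<^sub>2 L\<^sub>1\<^sub>1 = K (A\<^sub>1\<^sub>2 A\<^sub>1\<^sub>1) K\<^sup>T\<close>
  symmetric, so \<open>L\<close> is symplectic. If \<open>S = U U\<^sup>T\<close>, then \<open>L\<^sub>1\<^sub>1\<^sup>T U\<close> is orthogonal and upper
  triangular with positive diagonal, hence the identity.\<close>

lemma four_block_mat_eq_iff:
  assumes "A \<in> carrier_mat nr1 nc1" "B \<in> carrier_mat nr1 nc2"
    "C \<in> carrier_mat nr2 nc1" "D \<in> carrier_mat nr2 nc2"
    "A' \<in> carrier_mat nr1 nc1" "B' \<in> carrier_mat nr1 nc2"
    "C' \<in> carrier_mat nr2 nc1" "D' \<in> carrier_mat nr2 nc2"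
  shows "four_block_mat A B C D = four_block_mat A' B' C' D' \<longleftrightarrow>
    A = A' \<and> B = B' \<and> C = C' \<and> D = D'" (is "?M = ?M' \<longleftrightarrow> _")
proof
  assume eq: "?M = ?M'"
  have idx: "?M $$ (i, j) = ?M' $$ (i, j)" for i j
    by (simp add: eq)
  have "A $$ (i, j) = A' $$ (i, j)" if "i < nr1" "j < nc1" for i j
    using idx[of i j] that assms by simp
  moreover have "B $$ (i, j) = B' $$ (i, j)" if "i < nr1" "j < nc2" for i j
    using idx[of i "nc1 + j"] that assms by simp
  moreover have "C $$ (i, j) = C' $$ (i, j)" if "i < nr2" "j < nc1" for i j
    using idx[of "nr1 + i" j] that assms by simp
  moreover have "D $$ (i, j) = D' $$ (i, j)" if "i < nr2" "j < nc2" for i j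
    using idx[of "nr1 + i" "nc1 + j"] that assms by simp
  ultimately show "A = A' \<and> B = B' \<and> C = C' \<and> D = D'"
    using assms by (intro conjI eq_matI) auto
qed simp

text \<open>The two off-diagonal blocks of \<open>M\<^sup>T J M\<close> are negative transposes of
  each other, so four block equations reduce to three. Serves to unpack the hypothesis on
  \<open>A\<close> and to verify the claim on \<open>L\<close>.\<close>

lemma symplectic_four_block:
  assumes [simp]: "P \<in> carrier_mat n n" "Q \<in> carrier_mat n n"
    "R \<in> carrier_mat n n" "T \<in> carrier_mat n n"
  shows "symplectic n (four_block_mat P Q R T) \<longleftrightarrow>
    transpose_mat P * R = transpose_mat R * P \<and>
    transpose_mat Q * T = transpose_mat T * Q \<and>
    transpose_mat P * T - transpose_mat R * Q = 1\<^sub>m n" (is "symplectic n ?M \<longleftrightarrow> ?rel")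
proof -
  have M: "?M \<in> carrier_mat (2 * n) (2 * n)"
    using four_block_carrier_mat[of P n n T n n Q R] by (simp add: mult_2)
  have neg: "X * - 1\<^sub>m n = - X" if "X \<in> carrier_mat n n" for X :: "real mat"
    using that by (simp add: uminus_mult_right_mat)
  have "transpose_mat ?M * symp_J n = four_block_mat (- transpose_mat R) (transpose_mat P)
      (- transpose_mat T) (transpose_mat Q)"
    unfolding symp_J_def
    by (subst transpose_four_block_mat[of _ n n _ n _ n], simp_all,
        subst mult_four_block_mat[of _ n n _ n _ n _ _ n _ n])
      (simp_all add: neg right_mult_zero_mat[of _ n n] right_mult_one_mat[of _ n n]
        left_add_zero_mat[of _ n n] right_add_zero_mat[of _ n n])
  then have "transpose_mat ?M * symp_J n * ?M = four_block_mat
      (- transpose_mat R * P + transpose_mat P * R) (- transpose_mat R * Q + transpose_mat P * T)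
      (- transpose_mat T * P + transpose_mat Q * R) (- transpose_mat T * Q + transpose_mat Q * T)"
    by (simp add: mult_four_block_mat[of _ n n _ n _ n _ _ n _ n])
  then have "symplectic n ?M \<longleftrightarrow>
      - transpose_mat R * P + transpose_mat P * R = 0\<^sub>m n n \<and>
      - transpose_mat R * Q + transpose_mat P * T = 1\<^sub>m n \<and>
      - transpose_mat T * P + transpose_mat Q * R = - 1\<^sub>m n \<and>
      - transpose_mat T * Q + transpose_mat Q * T = 0\<^sub>m n n"
    using M by (simp add: symplectic_def symp_J_def four_block_mat_eq_iff[of _ n n _ n _ n]
        mult_carrier_mat[of _ n n _ n])
  also have "\<dots> \<longleftrightarrow> ?rel"
  proof -
    have sub: "- transpose_mat X * Y + Z = Z - transpose_mat X * Y"
      if "X \<in> carrier_mat n n" "Y \<in> carrier_mat n n" "Z \<in> carrier_mat n n" for X Y Z :: "real mat"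
      using that by (intro eq_matI) auto
    have eq0: "X - Y = 0\<^sub>m n n \<longleftrightarrow> X = Y"
      if "X \<in> carrier_mat n n" "Y \<in> carrier_mat n n" for X Y :: "real mat"
      using that by (auto simp: mat_eq_iff)
    \<comment> \<open>Makes the lower left equation a consequence of the upper right one.\<close>
    have "transpose_mat Q * R - transpose_mat T * P
        = - transpose_mat (transpose_mat P * T - transpose_mat R * Q)"
      using assms[THEN carrier_matD(1)] assms[THEN carrier_matD(2)]
      by (intro eq_matI) (auto simp: comm_scalar_prod[of _ n])
    then have "transpose_mat P * T - transpose_mat R * Q = 1\<^sub>m n \<Longrightarrow>
        transpose_mat Q * R - transpose_mat T * P = - 1\<^sub>m n"
      by simp
    then show ?thesis
      by (auto simp: sub eq0 mult_carrier_mat[of _ n n _ n])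
  qed
  finally show ?thesis .
qed

text \<open>For square matrices a right inverse is two-sided, which makes \<open>M\<close> a unit
  and rules out \<open>None\<close>; uniqueness of inverses then identifies the computed value with
  \<open>X\<close>.\<close>

lemma inv_mat_inverse:
  assumes M: "M \<in> carrier_mat n n" and X: "X \<in> carrier_mat n n" and MX: "M * X = 1\<^sub>m n"
  shows "inv_mat M = X" and "invertible_mat M"
proof -
  have XM: "X * M = 1\<^sub>m n"
    using mat_mult_left_right_inverse[OF M X MX] .
  have "M \<in> Units (ring_mat TYPE(real) n ())"
    using M X MX XM by (auto simp: Units_def ring_mat_simps)
  then obtain B where B: "mat_inverse M = Some B"
    using mat_inverse(1)[OF M, of "()"] by (cases "mat_inverse M") auto
  with mat_inverse(2)[OF M] have "M * B = 1\<^sub>m n" "B \<in> carrier_mat n n"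
    by auto
  then have "B = X"
    using assoc_mult_mat[OF X M, of B n] XM X by simp
  then show "inv_mat M = X"
    by (simp add: inv_mat_def B)
  show "invertible_mat M"
    using M X MX XM by (auto simp: invertible_mat_def inverts_mat_def)
qed

text \<open>The determinant is the product of the positive diagonal entries, hence nonzero.\<close>

lemma inv_mat_lower_triangular:
  assumes M: "M \<in> carrier_mat n n" and "lower_triangular M" "pos_diag M"
  shows "inv_mat M \<in> carrier_mat n n" "M * inv_mat M = 1\<^sub>m n" "inv_mat M * M = 1\<^sub>m n"
proof -
  have "det M = prod_list (diag_mat M)"
    using assms by (intro det_lower_triangular) (auto simp: lower_triangular_def)
  also have "\<dots> \<noteq> 0"
    using assms by (auto simp: prod_list_zero_iff diag_mat_def pos_diag_def)
  finally have "M \<in> Units (ring_mat TYPE(real) n ())"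
    by (rule det_non_zero_imp_unit[OF M])
  then obtain X where "X \<in> carrier_mat n n" "M * X = 1\<^sub>m n" "X * M = 1\<^sub>m n"
    by (auto simp: Units_def ring_mat_simps)
  moreover from this have "inv_mat M = X"
    by (intro inv_mat_inverse(1)[OF M])
  ultimately show "inv_mat M \<in> carrier_mat n n" "M * inv_mat M = 1\<^sub>m n" "inv_mat M * M = 1\<^sub>m n"
    by simp_all
qed

text \<open>The quadratic form at \<open>x\<close> is the squared norm of
  \<open>y = B\<^sup>T x\<close>, and \<open>C\<^sup>T y = x\<close> shows that \<open>y\<close>
  vanishes only with \<open>x\<close>.\<close>

lemma sym_pos_def_mult_transpose:
  assumes B: "B \<in> carrier_mat n n" and C: "C \<in> carrier_mat n n" and BC: "B * C = 1\<^sub>m n"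
  shows "sym_pos_def n (B * transpose_mat B)"
  unfolding sym_pos_def_def
proof (intro conjI ballI impI)
  show "B * transpose_mat B \<in> carrier_mat n n"
    using B by simp
  show "transpose_mat (B * transpose_mat B) = B * transpose_mat B"
    using B by (simp add: transpose_mult[of _ n n _ n])
  fix x :: "real vec"
  assume x: "x \<in> carrier_vec n" and "x \<noteq> 0\<^sub>v n"
  define y where "y = transpose_mat B *\<^sub>v x"
  have y: "y \<in> carrier_vec n"
    using B x by (simp add: y_def mult_mat_vec_carrier[of _ n n])
  have "transpose_mat C *\<^sub>v y = transpose_mat (B * C) *\<^sub>v x"
    using B C x by (simp add: y_def transpose_mult[of _ n n _ n])
  then have "transpose_mat C *\<^sub>v y = x"
    using BC x by simp
  moreover have "transpose_mat C *\<^sub>v 0\<^sub>v n = 0\<^sub>v n"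
    using C by (intro eq_vecI) auto
  ultimately have "y \<noteq> 0\<^sub>v n"
    using \<open>x \<noteq> 0\<^sub>v n\<close> by auto
  then obtain i where "i < n" "y $ i \<noteq> 0"
    using y by (metis carrier_vecD eq_vecI index_zero_vec)
  then have "0 < (\<Sum>i<n. y $ i * y $ i)"
    by (intro sum_pos2[of _ i]) (auto simp: zero_less_mult_iff linorder_neq_iff)
  also have "\<dots> = y \<bullet> y"
    using y by (simp add: scalar_prod_def lessThan_atLeast0)
  also have "\<dots> = x \<bullet> (B *\<^sub>v y)"
    using transpose_vec_mult_scalar[OF B y x] by (simp add: y_def)
  finally show "0 < x \<bullet> ((B * transpose_mat B) *\<^sub>v x)"
    using B x by (simp add: y_def)
qed

text \<open>A nonzero term \<open>M $$ (i, k) * N $$ (k, j)\<close> needs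
  \<open>i \<le> k \<le> j\<close>; with \<open>j \<le> i\<close> only \<open>k = i = j\<close>
  survives.\<close>

lemma upper_triangular_mult_entry:
  fixes M N :: "real mat"
  assumes M: "M \<in> carrier_mat n n" "upper_triangular M"
    and N: "N \<in> carrier_mat n n" "upper_triangular N"
    and "i < n" "j \<le> i"
  shows "(M * N) $$ (i, j) = (if j = i then M $$ (i, i) * N $$ (i, i) else 0)"
proof -
  have "(M * N) $$ (i, j) = (\<Sum>k<n. M $$ (i, k) * N $$ (k, j))"
    using assms by (simp add: scalar_prod_def lessThan_atLeast0)
  also have "\<dots> = (\<Sum>k<n. if k = i \<and> j = i then M $$ (i, i) * N $$ (i, i) else 0)"
  proof (rule sum.cong)
    fix k assume "k \<in> {..<n}"
    then show "M $$ (i, k) * N $$ (k, j) =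
        (if k = i \<and> j = i then M $$ (i, i) * N $$ (i, i) else 0)"
      using assms upper_triangularD[OF M(2), of k i] upper_triangularD[OF N(2), of j k]
      by (cases k i rule: linorder_cases) auto
  qed simp
  also have "\<dots> = (if j = i then M $$ (i, i) * N $$ (i, i) else 0)"
    using \<open>i < n\<close> by auto
  finally show ?thesis .
qed

text \<open>Induction on rows. In entry \<open>(i, j)\<close> of \<open>X\<^sup>T X\<close>, the
  terms \<open>k > i\<close> vanish by triangularity and the terms \<open>k < i\<close> because row
  \<open>k\<close> is already that of the identity. This leaves
  \<open>X $$ (i, i) * X $$ (i, j)\<close>.\<close>

lemma orthogonal_upper_triangular_eq_one:
  fixes X :: "real mat"
  assumes X: "X \<in> carrier_mat n n" "upper_triangular X" "pos_diag X"
    and orth: "transpose_mat X * X = 1\<^sub>m n"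
  shows "X = 1\<^sub>m n"
proof -
  have "\<forall>j<n. X $$ (i, j) = (if i = j then 1 else 0)" if "i < n" for i
    using that
  proof (induction i rule: less_induct)
    case (less i)
    have entry: "X $$ (i, i) * X $$ (i, j) = (if i = j then 1 else 0)" if "j < n" for j
    proof -
      have "(transpose_mat X * X) $$ (i, j) = (\<Sum>k<n. X $$ (k, i) * X $$ (k, j))"
        using X less.prems that by (simp add: scalar_prod_def lessThan_atLeast0)
      also have "\<dots> = (\<Sum>k<n. if k = i then X $$ (i, i) * X $$ (i, j) else 0)"
      proof (rule sum.cong)
        fix k assume "k \<in> {..<n}"
        then show "X $$ (k, i) * X $$ (k, j) = (if k = i then X $$ (i, i) * X $$ (i, j) else 0)"
          using less X upper_triangularD[OF X(2), of i k]
          by (cases k i rule: linorder_cases) auto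
      qed simp
      finally show ?thesis
        using less.prems that orth by simp
    qed
    have "X $$ (i, i) > 0"
      using X less.prems by (simp add: pos_diag_def)
    \<comment> \<open>The case \<open>j = i\<close> says that the square of the diagonal entry is 1;
      positivity excludes -1.\<close>
    moreover from this entry[OF less.prems] have "X $$ (i, i) = 1"
      using power2_eq_1_iff[of "X $$ (i, i)"] by (simp add: power2_eq_square)
    ultimately show ?case
      using entry by simp
  qed
  then show ?thesis
    using X by (intro eq_matI) auto
qed

theorem theorem1p8:
  fixes n :: nat and A A11 A12 A22 L11 L21 L22 L S :: "real mat"
  assumes "sym_pos_def (2 * n) A"
    and "symplectic n A"
    and "A11 \<in> carrier_mat n n" "A12 \<in> carrier_mat n n" "A22 \<in> carrier_mat n n"
    and "A = four_block_mat A11 A12 (transpose_mat A12) A22"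
    and "is_cholesky n A11 L11"
    and "L21 = transpose_mat (inv_mat L11 * A12)"
    and "L22 = transpose_mat (inv_mat L11)"
    and "L = four_block_mat L11 (0\<^sub>m n n) L21 L22"
    and "S = schur_complement A11 A12 A22"
  shows "sym_pos_def n A11 \<and> invertible_mat A11 \<and> invertible_mat L11 \<and>
    A = L * transpose_mat L \<and> symplectic n L \<and>
    sym_pos_def n S \<and>
    (\<forall>U. is_reverse_cholesky n S U \<longrightarrow> L22 = transpose_mat (inv_mat L11) \<and> transpose_mat (inv_mat L11) = U)"
proof -
  define K where "K = inv_mat L11"
  note [simp] = assms(3-5) mult_carrier_mat[of _ n n _ n] left_mult_one_mat[of _ n n]
    right_mult_one_mat[of _ n n] left_mult_zero_mat[of _ n n] right_mult_zero_mat[of _ n n]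
    left_add_zero_mat[of _ n n] right_add_zero_mat[of _ n n] and transp = transpose_mult[of _ n n _ n]
  have assoc [simp]: "X * Y * Z = X * (Y * Z)"
    if "X \<in> carrier_mat n n" "Y \<in> carrier_mat n n" "Z \<in> carrier_mat n n" for X Y Z :: "real mat"
    using that by simp
  have chol [simp]: "L11 \<in> carrier_mat n n" and lower: "lower_triangular L11" "pos_diag L11"
    and A11: "A11 = L11 * transpose_mat L11"
    using assms(7) by (auto simp: is_cholesky_def)
  have K [simp]: "K \<in> carrier_mat n n" and LK: "L11 * K = 1\<^sub>m n" and KL: "K * L11 = 1\<^sub>m n"
    using inv_mat_lower_triangular[OF chol lower] by (simp_all add: K_def)
  have KtLt: "transpose_mat K * transpose_mat L11 = 1\<^sub>m n"
    and LtKt: "transpose_mat L11 * transpose_mat K = 1\<^sub>m n"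
    using arg_cong[OF LK, of transpose_mat] arg_cong[OF KL, of transpose_mat]
    by (simp_all add: transp)
  \<comment> \<open>Since \<open>assoc\<close> nests products to the right, inverse pairs meet in
    front of a trailing factor \<open>X\<close>.\<close>
  have cancel: "L11 * (K * X) = X" "K * (L11 * X) = X"
    "transpose_mat K * (transpose_mat L11 * X) = X" "transpose_mat L11 * (transpose_mat K * X) = X"
    if "X \<in> carrier_mat n n" for X
    using that LK KL KtLt LtKt by (simp_all del: assoc assoc_mult_mat flip: assoc)

  have symA11: "transpose_mat A11 = A11"
    by (simp add: A11 transp)
  have comm: "A11 * transpose_mat A12 = A12 * A11" and ident: "A11 * A22 - A12 * A12 = 1\<^sub>m n"
    using assms(2) by (simp_all add: assms(6) symplectic_four_block symA11)

  have A11_inv: "A11 * (transpose_mat K * K) = 1\<^sub>m n"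
    by (simp add: A11 cancel LK)
  note inv_A11 = inv_mat_inverse[OF assms(3) _ A11_inv, simplified]

  \<comment> \<open>Multiplying \<open>comm\<close> by
    \<open>A11\<^sup>-\<^sup>1 = K\<^sup>T K\<close> on both sides moves the inverse across:
    \<open>A12\<^sup>T A11\<^sup>-\<^sup>1 = A11\<^sup>-\<^sup>1 A12\<close>.\<close>
  have "transpose_mat K * (K * (A11 * transpose_mat A12 * (transpose_mat K * K)))
      = transpose_mat K * (K * (A12 * (A11 * (transpose_mat K * K))))"
    by (simp add: comm)
  then have A12_swap: "transpose_mat A12 * (transpose_mat K * K) = transpose_mat K * (K * A12)"
    using A11_inv by (simp add: A11 cancel)

  have "S = A22 - transpose_mat A12 * (transpose_mat K * K) * A12"
    by (simp add: assms(11) schur_complement_def inv_A11)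
  also have "\<dots> = A22 - transpose_mat K * (K * (A12 * A12))"
    by (simp only: A12_swap) simp
  \<comment> \<open>Writing \<open>A22\<close> as \<open>A11\<^sup>-\<^sup>1 A11 A22\<close> lets
    the inverse factor out, so that \<open>ident\<close> applies.\<close>
  also have "\<dots> = transpose_mat K * K * (A11 * A22) - transpose_mat K * K * (A12 * A12)"
    by (simp add: A11 cancel)
  also have "\<dots> = transpose_mat K * K * (A11 * A22 - A12 * A12)"
    by (rule mult_minus_distrib_mat[of _ n n _ n, symmetric]) auto
  finally have S: "S = transpose_mat K * K"
    by (simp add: ident)

  have L21: "L21 = transpose_mat A12 * transpose_mat K" and L22: "L22 = transpose_mat K"
    by (simp_all add: assms(8,9) transp flip: K_def)
  have [simp]: "L21 \<in> carrier_mat n n" "L22 \<in> carrier_mat n n"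
    by (simp_all add: L21 L22)

  have A22_split: "A22 = X + (A22 - X)" if "X \<in> carrier_mat n n" for X
    using that carrier_matD[OF assms(5)] by (intro eq_matI) auto
  \<comment> \<open>Solving the definition of \<open>S\<close> for \<open>A22\<close> gives the
    lower right block of \<open>L L\<^sup>T\<close>, because
    \<open>S = L22 L22\<^sup>T\<close>.\<close>
  have "A22 = transpose_mat A12 * (transpose_mat K * K) * A12 + S"
    using A22_split[of "transpose_mat A12 * (transpose_mat K * K) * A12"]
    by (simp add: assms(11) schur_complement_def inv_A11)
  then have "A22 = L21 * transpose_mat L21 + L22 * transpose_mat L22"
    by (simp add: L21 L22 S transp)
  then have A: "A = L * transpose_mat L"
    by (simp add: assms(6,10) transpose_four_block_mat[of _ n n _ n _ n]
        mult_four_block_mat[of _ n n _ n _ n _ _ n _ n])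
      (simp add: A11 L21 transp cancel KtLt)

  \<comment> \<open>By \<open>comm\<close>, \<open>A12 * A11\<close> is symmetric, and so is its
    congruence by \<open>K\<close>. Cancelling \<open>L11\<^sup>T K\<^sup>T\<close> turns the latter
    into \<open>K A12 L11 = L21\<^sup>T L11\<close>.\<close>
  have "transpose_mat (K * (A12 * A11) * transpose_mat K) = K * (A12 * A11) * transpose_mat K"
    by (simp add: transp symA11 flip: comm)
  then have "transpose_mat L11 * L21 = transpose_mat L21 * L11"
    by (simp add: transp A11 L21 cancel LtKt)
  \<comment> \<open>The zero block makes the second relation trivial and reduces the third to
    \<open>L11\<^sup>T L22 = 1\<close>.\<close>
  then have symp: "symplectic n L"
    by (simp add: assms(10) symplectic_four_block) (auto simp: L22 LtKt)

  have U: "transpose_mat K = U" if "is_reverse_cholesky n S U" for U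
  proof -
    have Uc [simp]: "U \<in> carrier_mat n n" and upper: "upper_triangular U" "pos_diag U"
      and SU: "S = U * transpose_mat U"
      using that by (auto simp: is_reverse_cholesky_def)
    define X where "X = transpose_mat L11 * U"
    have X [simp]: "X \<in> carrier_mat n n"
      by (simp add: X_def)
    have "upper_triangular (transpose_mat L11)"
      using lower(1) carrier_matD[OF chol] by (auto simp: lower_triangular_def)
    then have entry: "X $$ (i, j) = (if j = i then L11 $$ (i, i) * U $$ (i, i) else 0)"
      if "i < n" "j \<le> i" for i j
      using upper_triangular_mult_entry[of "transpose_mat L11" n U i j] that upper(1) carrier_matD[OF chol]
      by (simp add: X_def)
    have "X * transpose_mat X = transpose_mat L11 * S * L11"
      by (simp add: X_def SU transp)
    also have "\<dots> = 1\<^sub>m n"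
      by (simp add: S cancel KL)
    \<comment> \<open>\<open>X\<close> is square, so the factors may be swapped into the order that
      the row induction uses.\<close>
    finally have "transpose_mat X * X = 1\<^sub>m n"
      by (intro mat_mult_left_right_inverse[of X]) auto
    moreover have "upper_triangular X" "pos_diag X"
      using entry lower(2) upper(2) carrier_matD[OF X] carrier_matD[OF chol] carrier_matD[OF Uc] by (auto simp: pos_diag_def)
    ultimately have "X = 1\<^sub>m n"
      by (intro orthogonal_upper_triangular_eq_one[of X n]) auto
    then have "transpose_mat K * X = transpose_mat K"
      by simp
    then show ?thesis
      by (simp add: X_def cancel)
  qed

  \<comment> \<open>Both matrices have the form \<open>B B\<^sup>T\<close>: \<open>B = L11\<close>
    has inverse \<open>K\<close>, and for \<open>S\<close> the factor \<open>B = K\<^sup>T\<close>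
    has inverse \<open>L11\<^sup>T\<close>.\<close>
  have "sym_pos_def n A11"
    using sym_pos_def_mult_transpose[OF chol K LK] by (simp add: A11)
  moreover have "sym_pos_def n S"
    using sym_pos_def_mult_transpose[of "transpose_mat K" n "transpose_mat L11"] KtLt by (simp add: S)
  ultimately show ?thesis
    using inv_A11(2) inv_mat_inverse(2)[OF chol K LK] A symp U L22 by (simp flip: K_def)
qed

end
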